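(* Let $\phi:\mathbb R\to[0,+\infty]$ be an Orlicz function with $ces_\phi\neq\{0\}$, and let $$A_\phi=\Big\{x\in ces_\phi:\ \forall k>0\ \exists n_k\in\mathbb N\ \ \sum_{n=n_k}^\infty\phi\Big(\frac kn\sum_{i=1}^n|x(i)|\Big)<\infty\Big\}.$$ Then the following assertions are true: (i) $A_\phi$ is a closed separable subspace of $ces_\phi$; (ii) $A_\phi$ is the norm closure in $ces_\phi$ of $\{x\in ces_\phi:\ x(i)\neq0\text{ only for a finite number of }i\in\mathbb N\}$; (iii) $A_\phi$ is the subspace of all order continuous elements of $ces_\phi$.
   Context: A map $\phi:\mathbb R\to[0,+\infty]$ is an Orlicz function if it is even, convex, left continuous on $\mathbb R_+=[0,\infty)$, continuous at zero, $\phi(0)=0$ and $\phi(u)\to\infty$ as $u\to\infty$ (the value $+\infty$ is allowed). Let $l^0$ be the space of all real sequences $x=(x(i))_{i=1}^\infty$. For $x\in l^0$ put $\sigma x(i)=\frac1i\sum_{j=1}^i|x(j)|$ and $\rho_\phi(x)=\sum_{i=1}^\infty\phi(\sigma x(i))$. The Cesàro–Orlicz sequence space is $ces_\phi=\{x\in l^0:\ \rho_\phi(\lambda x)<\infty\text{ for some }\lambda>0\}$, equipped with the Luxemburg norm $\|x\|_\phi=\inf\{\lambda>0:\rho_\phi(x/\lambda)\le1\}$. An element $x\in ces_\phi$ is called order continuous if for any sequence $(x_n)$ of coordinatewise nonnegative elements of $ces_\phi$ such that $x_n\le|x|$ coordinatewise for all $n$ and $x_n\to0$ coordinatewise, we have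 $\|x_n\|_\phi\to0$. *)

theory Defs
  imports "HOL-Analysis.Analysis" "HOL-Library.Function_Algebras"
begin

text \<open>
  A real sequence \<open>(x(1), x(2), \<dots>)\<close> is represented by \<open>x :: nat \<Rightarrow> real\<close> with \<open>x i\<close>
  standing for \<open>x(i+1)\<close>; sums of values in \<open>[0, \<infinity>]\<close> are taken in \<^typ>\<open>ennreal\<close>.
\<close>

definition orlicz :: "(real \<Rightarrow> ennreal) \<Rightarrow> bool" where
  "orlicz \<phi> \<longleftrightarrow>
     (\<forall>u. \<phi> (- u) = \<phi> u) \<and>
     (\<forall>u v t. 0 \<le> t \<and> t \<le> 1 \<longrightarrow>
        \<phi> ((1 - t) * u + t * v) \<le> ennreal (1 - t) * \<phi> u + ennreal t * \<phi> v) \<and>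
     (\<forall>u\<ge>0. continuous (at_left u) \<phi>) \<and>
     isCont \<phi> 0 \<and>
     \<phi> 0 = 0 \<and>
     (\<phi> \<longlongrightarrow> \<infinity>) at_top"

definition cesaro :: "(nat \<Rightarrow> real) \<Rightarrow> nat \<Rightarrow> real" where
  "cesaro x n = 1 / real (Suc n) * (\<Sum>j\<le>n. \<bar>x j\<bar>)"

definition modular :: "(real \<Rightarrow> ennreal) \<Rightarrow> (nat \<Rightarrow> real) \<Rightarrow> ennreal" where
  "modular \<phi> x = (\<Sum>n. \<phi> (cesaro x n))"

definition ces :: "(real \<Rightarrow> ennreal) \<Rightarrow> (nat \<Rightarrow> real) set" where
  "ces \<phi> = {x. \<exists>l>0. modular \<phi> (\<lambda>i. l * x i) < \<infinity>}"

definition lux_norm :: "(real \<Rightarrow> ennreal) \<Rightarrow> (nat \<Rightarrow> real) \<Rightarrow> real" where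
  "lux_norm \<phi> x = Inf {l. l > 0 \<and> modular \<phi> (\<lambda>i. x i / l) \<le> 1}"

text \<open>
  The locale \<^locale>\<open>Metric_space\<close> asks for nonnegativity on the whole type, while
  \<^const>\<open>lux_norm\<close> takes the infimum of the empty set outside \<open>ces \<phi>\<close>; hence the cut-off.
\<close>

definition ces_dist :: "(real \<Rightarrow> ennreal) \<Rightarrow> (nat \<Rightarrow> real) \<Rightarrow> (nat \<Rightarrow> real) \<Rightarrow> real" where
  "ces_dist \<phi> x y = (if x \<in> ces \<phi> \<and> y \<in> ces \<phi> then lux_norm \<phi> (x - y) else 0)"

text \<open>The norm topology; that \<open>ces_dist\<close> is a metric is lemma \<open>Metric_space_ces\<close> below.\<close>

definition ces_topology :: "(real \<Rightarrow> ennreal) \<Rightarrow> (nat \<Rightarrow> real) topology" where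
  "ces_topology \<phi> = Metric_space.mtopology (ces \<phi>) (ces_dist \<phi>)"

definition A_ces :: "(real \<Rightarrow> ennreal) \<Rightarrow> (nat \<Rightarrow> real) set" where
  "A_ces \<phi> = {x \<in> ces \<phi>. \<forall>k::real>0. \<exists>m.
      (\<Sum>n. \<phi> (k / real (Suc (n + m)) * (\<Sum>i\<le>n + m. \<bar>x i\<bar>))) < \<infinity>}"

definition order_continuous :: "(real \<Rightarrow> ennreal) \<Rightarrow> (nat \<Rightarrow> real) \<Rightarrow> bool" where
  "order_continuous \<phi> x \<longleftrightarrow> x \<in> ces \<phi> \<and>
     (\<forall>X :: nat \<Rightarrow> nat \<Rightarrow> real.
        (\<forall>n. X n \<in> ces \<phi> \<and> (\<forall>i. 0 \<le> X n i \<and> X n i \<le> \<bar>x i\<bar>)) \<and>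
        (\<forall>i. (\<lambda>n. X n i) \<longlonglongrightarrow> 0)
        \<longrightarrow> (\<lambda>n. lux_norm \<phi> (X n)) \<longlonglongrightarrow> 0)"

text \<open>The space of all real sequences with pointwise operations; this provides \<open>seq.subspace\<close>.\<close>

interpretation seq: vector_space "\<lambda>(c::real) (x::nat \<Rightarrow> real) i. c * x i"
  by unfold_locales (auto simp: fun_eq_iff algebra_simps)

lemma orlicz_scale:
  assumes "orlicz \<phi>" "0 \<le> t" "t \<le> 1"
  shows "\<phi> (t * u) \<le> ennreal t * \<phi> u"
proof -
  have "\<phi> ((1 - t) * 0 + t * u) \<le> ennreal (1 - t) * \<phi> 0 + ennreal t * \<phi> u"
    using assms unfolding orlicz_def by blast
  then show ?thesis using assms by (simp add: orlicz_def)
qed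

lemma orlicz_mono:
  assumes "orlicz \<phi>" "0 \<le> u" "u \<le> v"
  shows "\<phi> u \<le> \<phi> v"
proof (cases "v = 0")
  case False
  then have v: "v > 0" using assms by simp
  have "\<phi> u = \<phi> (u / v * v)" using v by simp
  also have "\<dots> \<le> ennreal (u / v) * \<phi> v"
    using assms v by (intro orlicz_scale) auto
  also have "\<dots> \<le> 1 * \<phi> v"
    using assms v by (intro mult_right_mono) (auto simp: ennreal_le_1)
  finally show ?thesis by simp
qed (use assms in simp)

lemma cesaro_nonneg: "0 \<le> cesaro x n"
  by (simp add: cesaro_def sum_nonneg)

lemma cesaro_scale: "cesaro (\<lambda>i. c * x i) n = \<bar>c\<bar> * cesaro x n"
  by (simp add: cesaro_def abs_mult sum_distrib_left[symmetric])

lemma cesaro_add: "cesaro (\<lambda>i. x i + y i) n \<le> cesaro x n + cesaro y n"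
proof -
  have "(\<Sum>j\<le>n. \<bar>x j + y j\<bar>) \<le> (\<Sum>j\<le>n. \<bar>x j\<bar>) + (\<Sum>j\<le>n. \<bar>y j\<bar>)"
    by (simp add: sum.distrib[symmetric] sum_mono)
  then show ?thesis
    by (simp add: cesaro_def add_divide_distrib[symmetric] divide_right_mono)
qed

lemma modular_scale:
  assumes "orlicz \<phi>" "0 \<le> t" "t \<le> 1"
  shows "modular \<phi> (\<lambda>i. t * x i) \<le> ennreal t * modular \<phi> x"
proof -
  have "modular \<phi> (\<lambda>i. t * x i) \<le> (\<Sum>n. ennreal t * \<phi> (cesaro x n))"
    unfolding modular_def cesaro_scale using assms
    by (intro suminf_le) (auto intro: orlicz_scale)
  then show ?thesis by (simp add: modular_def ennreal_suminf_cmult)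
qed

lemma modular_convex:
  assumes "orlicz \<phi>" "0 \<le> t" "t \<le> 1"
  shows "modular \<phi> (\<lambda>i. (1 - t) * x i + t * y i)
    \<le> ennreal (1 - t) * modular \<phi> x + ennreal t * modular \<phi> y"
proof -
  have *: "\<phi> (cesaro (\<lambda>i. (1 - t) * x i + t * y i) n)
      \<le> ennreal (1 - t) * \<phi> (cesaro x n) + ennreal t * \<phi> (cesaro y n)" for n
  proof -
    have "cesaro (\<lambda>i. (1 - t) * x i + t * y i) n \<le> (1 - t) * cesaro x n + t * cesaro y n"
      using cesaro_add[of "\<lambda>i. (1 - t) * x i" "\<lambda>i. t * y i" n] assms
      by (simp add: cesaro_scale)
    then have "\<phi> (cesaro (\<lambda>i. (1 - t) * x i + t * y i) n)
        \<le> \<phi> ((1 - t) * cesaro x n + t * cesaro y n)"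
      by (intro orlicz_mono assms cesaro_nonneg)
    also have "\<dots> \<le> ennreal (1 - t) * \<phi> (cesaro x n) + ennreal t * \<phi> (cesaro y n)"
      using assms unfolding orlicz_def by blast
    finally show ?thesis .
  qed
  have "modular \<phi> (\<lambda>i. (1 - t) * x i + t * y i)
      \<le> (\<Sum>n. ennreal (1 - t) * \<phi> (cesaro x n) + ennreal t * \<phi> (cesaro y n))"
    unfolding modular_def by (intro suminf_le *) auto
  then show ?thesis
    by (simp add: modular_def ennreal_suminf_cmult suminf_add[symmetric])
qed

lemma modular_uminus: "modular \<phi> (\<lambda>i. - x i) = modular \<phi> x"
  by (simp add: modular_def cesaro_def)

lemma lux_norm_bdd: "bdd_below {l. l > 0 \<and> modular \<phi> (\<lambda>i. x i / l) \<le> 1}"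
  by (rule bdd_belowI[of _ 0]) auto

lemma ces_unit:
  assumes "orlicz \<phi>" "x \<in> ces \<phi>"
  shows "{l. l > 0 \<and> modular \<phi> (\<lambda>i. x i / l) \<le> 1} \<noteq> {}"
proof -
  obtain l where l: "l > 0" "modular \<phi> (\<lambda>i. l * x i) < \<infinity>"
    using assms by (auto simp: ces_def)
  then obtain r where r: "r \<ge> 0" "modular \<phi> (\<lambda>i. l * x i) = ennreal r"
    by (metis ennreal_cases infinity_ennreal_def less_irrefl)
  define t where "t = 1 / (1 + r)"
  have t: "0 < t" "t \<le> 1" "t * r \<le> 1" using r by (auto simp: t_def)
  have "modular \<phi> (\<lambda>i. t * (l * x i)) \<le> ennreal t * ennreal r"
    using modular_scale[of \<phi> t "\<lambda>i. l * x i"] assms(1) t unfolding r(2) by simp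
  also have "\<dots> = ennreal (t * r)" using r t by (simp add: ennreal_mult)
  also have "\<dots> \<le> 1" using t by (simp add: ennreal_le_1)
  finally have le: "modular \<phi> (\<lambda>i. t * (l * x i)) \<le> 1" .
  have "(\<lambda>i. t * (l * x i)) = (\<lambda>i. x i / (1 / (t * l)))" by (simp add: fun_eq_iff)
  with le have "modular \<phi> (\<lambda>i. x i / (1 / (t * l))) \<le> 1" by (simp only:)
  moreover have "1 / (t * l) > 0" using t l by simp
  ultimately show ?thesis by blast
qed

lemma lux_norm_nonneg:
  assumes "orlicz \<phi>" "x \<in> ces \<phi>"
  shows "0 \<le> lux_norm \<phi> x"
  unfolding lux_norm_def by (rule cInf_greatest[OF ces_unit[OF assms]]) simp

lemma modular_le_1:
  assumes "orlicz \<phi>" "x \<in> ces \<phi>" "lux_norm \<phi> x < a"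
  shows "modular \<phi> (\<lambda>i. x i / a) \<le> 1"
proof -
  obtain l where l: "l > 0" "l < a" "modular \<phi> (\<lambda>i. x i / l) \<le> 1"
    using assms(3) cInf_less_iff[OF ces_unit[OF assms(1,2)] lux_norm_bdd]
    unfolding lux_norm_def by blast
  have "modular \<phi> (\<lambda>i. l / a * (x i / l)) \<le> ennreal (l / a) * modular \<phi> (\<lambda>i. x i / l)"
    using l assms by (intro modular_scale) auto
  also have "\<dots> \<le> 1 * 1"
    using l by (intro mult_mono) (auto simp: ennreal_le_1)
  finally show ?thesis using l by simp
qed

lemma lux_norm_le:
  assumes "l > 0" "modular \<phi> (\<lambda>i. x i / l) \<le> 1"
  shows "lux_norm \<phi> x \<le> l"
  unfolding lux_norm_def by (rule cInf_lower[OF _ lux_norm_bdd]) (use assms in blast)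

lemma cesI:
  assumes "l > 0" "modular \<phi> (\<lambda>i. x i / l) \<le> 1"
  shows "x \<in> ces \<phi>"
proof -
  have "modular \<phi> (\<lambda>i. 1 / l * x i) < \<infinity>"
    using order.strict_trans1[OF assms(2) ennreal_one_less_top] by simp
  then show ?thesis using assms(1) unfolding ces_def by (intro CollectI exI[of _ "1 / l"]) simp
qed

lemma ces_add_modular:
  assumes "orlicz \<phi>" "x \<in> ces \<phi>" "y \<in> ces \<phi>" "lux_norm \<phi> x < a" "lux_norm \<phi> y < b"
  shows "modular \<phi> (\<lambda>i. (x + y) i / (a + b)) \<le> 1"
proof -
  have ab: "a > 0" "b > 0" 
    using lux_norm_nonneg[OF assms(1,2)] lux_norm_nonneg[OF assms(1,3)] assms(4,5) by linarith+
  define t where "t = b / (a + b)"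
  have t: "0 \<le> t" "t \<le> 1" and t': "1 - t = a / (a + b)"
    using ab by (auto simp: t_def field_simps)
  have "(\<lambda>i. (x + y) i / (a + b)) = (\<lambda>i. (1 - t) * (x i / a) + t * (y i / b))"
    unfolding t' using ab by (simp add: t_def add_divide_distrib)
  then have "modular \<phi> (\<lambda>i. (x + y) i / (a + b)) \<le>
      ennreal (1 - t) * modular \<phi> (\<lambda>i. x i / a) + ennreal t * modular \<phi> (\<lambda>i. y i / b)"
    by (simp only: modular_convex[OF assms(1) t])
  also have "\<dots> \<le> ennreal (1 - t) * 1 + ennreal t * 1"
    using assms by (intro add_mono mult_left_mono modular_le_1) auto
  also have "\<dots> = 1" using t by (simp flip: ennreal_plus)
  finally show ?thesis .
qed

lemma ces_add:
  assumes "orlicz \<phi>" "x \<in> ces \<phi>" "y \<in> ces \<phi>"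
  shows "x + y \<in> ces \<phi>"
proof (rule cesI)
  let ?a = "lux_norm \<phi> x + 1" and ?b = "lux_norm \<phi> y + 1"
  show "modular \<phi> (\<lambda>i. (x + y) i / (?a + ?b)) \<le> 1"
    using assms by (intro ces_add_modular) auto
  show "?a + ?b > 0" using lux_norm_nonneg[OF assms(1,2)] lux_norm_nonneg[OF assms(1,3)] by linarith
qed

lemma lux_norm_triangle:
  assumes "orlicz \<phi>" "x \<in> ces \<phi>" "y \<in> ces \<phi>"
  shows "lux_norm \<phi> (x + y) \<le> lux_norm \<phi> x + lux_norm \<phi> y"
proof (rule field_le_epsilon)
  fix e :: real assume e: "e > 0"
  let ?a = "lux_norm \<phi> x + e / 2" and ?b = "lux_norm \<phi> y + e / 2"
  have "lux_norm \<phi> (x + y) \<le> ?a + ?b"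
  proof (rule lux_norm_le)
    show "modular \<phi> (\<lambda>i. (x + y) i / (?a + ?b)) \<le> 1"
      using assms e by (intro ces_add_modular) auto
    show "?a + ?b > 0" using e lux_norm_nonneg[OF assms(1,2)] lux_norm_nonneg[OF assms(1,3)] by linarith
  qed
  then show "lux_norm \<phi> (x + y) \<le> lux_norm \<phi> x + lux_norm \<phi> y + e" by simp
qed

lemma ces_uminus: "x \<in> ces \<phi> \<Longrightarrow> - x \<in> ces \<phi>"
  by (simp add: ces_def modular_uminus)

lemma lux_norm_uminus: "lux_norm \<phi> (- x) = lux_norm \<phi> x"
  by (simp add: lux_norm_def modular_uminus)

lemma lux_norm_0:
  assumes "orlicz \<phi>"
  shows "lux_norm \<phi> 0 = 0"
proof -
  have "modular \<phi> (\<lambda>i. (0::nat \<Rightarrow> real) i / l) \<le> 1" for l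
    using assms by (simp add: modular_def cesaro_def orlicz_def)
  then have "{l. l > 0 \<and> modular \<phi> (\<lambda>i. (0::nat \<Rightarrow> real) i / l) \<le> 1} = {0<..}" by auto
  then show ?thesis by (simp add: lux_norm_def)
qed

lemma lux_norm_eq_0:
  assumes "orlicz \<phi>" "x \<in> ces \<phi>" "lux_norm \<phi> x = 0"
  shows "x = 0"
proof (rule ccontr)
  assume "x \<noteq> 0"
  then obtain n where n: "x n \<noteq> 0" by (auto simp: fun_eq_iff)
  have "(\<Sum>j\<le>n. \<bar>x j\<bar>) > 0"
    by (rule sum_pos2[of _ n]) (use n in auto)
  then have c: "cesaro x n > 0" by (simp add: cesaro_def)
  have le: "\<phi> u \<le> 1" if "u > 0" for u
  proof -
    define l where "l = cesaro x n / u"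
    have l: "l > 0" using c that by (simp add: l_def)
    have "u = cesaro (\<lambda>i. x i / l) n"
      using cesaro_scale[of "1 / l" x n] l c that by (simp add: l_def mult.commute)
    then have "\<phi> u \<le> modular \<phi> (\<lambda>i. x i / l)"
      unfolding modular_def
      using sum_le_suminf[of "\<lambda>n. \<phi> (cesaro (\<lambda>i. x i / l) n)" "{n}"] by simp
    also have "\<dots> \<le> 1" using assms l by (intro modular_le_1) auto
    finally show ?thesis .
  qed
  have "(\<phi> \<longlongrightarrow> \<infinity>) at_top" using assms by (simp add: orlicz_def)
  then have "eventually (\<lambda>u. \<phi> u > 1) at_top"
    by (rule order_tendstoD) simp
  then have "eventually (\<lambda>u::real. False) at_top"
    using eventually_gt_at_top[of 0] by eventually_elim (use le leD in blast)
  then show False by simp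
qed

lemma Metric_space_ces:
  assumes "orlicz \<phi>"
  shows "Metric_space (ces \<phi>) (ces_dist \<phi>)"
proof -
  have sym: "ces_dist \<phi> x y = ces_dist \<phi> y x" for x y
    using lux_norm_uminus[of \<phi> "x - y"] by (simp add: ces_dist_def)
  have diff: "x - y \<in> ces \<phi>" if "x \<in> ces \<phi>" "y \<in> ces \<phi>" for x y
    using ces_add[OF assms that(1) ces_uminus[OF that(2)]] by simp
  show ?thesis
  proof
    show "0 \<le> ces_dist \<phi> x y" for x y
      using lux_norm_nonneg[OF assms diff] by (simp add: ces_dist_def)
    show "ces_dist \<phi> x y = ces_dist \<phi> y x" for x y by (rule sym)
    show "ces_dist \<phi> x y = 0 \<longleftrightarrow> x = y" if "x \<in> ces \<phi>" "y \<in> ces \<phi>" for x y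
      using lux_norm_eq_0[OF assms diff[OF that]] lux_norm_0[OF assms] that
      by (auto simp: ces_dist_def)
    show "ces_dist \<phi> x z \<le> ces_dist \<phi> x y + ces_dist \<phi> y z"
      if "x \<in> ces \<phi>" "y \<in> ces \<phi>" "z \<in> ces \<phi>" for x y z
      using lux_norm_triangle[OF assms diff[OF that(1,2)] diff[OF that(2,3)]] that
      by (simp add: ces_dist_def)
  qed
qed

end

theory Submission
  imports Defs
begin

text \<open>
  The three descriptions are linked in a cycle: elements of \<open>A_ces \<phi>\<close> are order continuous
  (split the modular into a small tail and finitely many terms that vanish in the limit); an order
  continuous element is the limit of its truncations; and \<open>A_ces \<phi>\<close> is norm closed by
  convexity of \<open>\<phi>\<close> and contains the finitely supported sequences. The last inclusion is where
  \<open>ces \<phi> \<noteq> {0}\<close> enters: a nonzero element gives convergence of \<open>\<Sum> \<phi> (a / n)\<close> for one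
  \<open>a > 0\<close>, and repeating each term of that series \<open>N\<close> times bounds \<open>\<Sum> \<phi> (k / n)\<close> for any
  \<open>k \<le> N * a\<close>.
\<close>

section \<open>Tails and block repetition of series in \<open>[0, \<infinity>]\<close>\<close>

text \<open>Avoids subtraction in \<open>ennreal\<close>: a finite total lies strictly below
  \<open>e\<close> plus itself, hence below \<open>e\<close> plus some partial sum, and a remaining
  tail of size at least \<open>e\<close> would contradict this.\<close>

lemma ennreal_suminf_tail_less:
  fixes f :: "nat \<Rightarrow> ennreal"
  assumes "(\<Sum>n. f n) < \<infinity>" "e > 0"
  shows "\<exists>M. (\<Sum>n. f (n + M)) < e"
proof -
  have "(\<lambda>n. (\<Sum>i<n. f i)) \<longlonglongrightarrow> (\<Sum>n. f n)"
    by (intro summable_LIMSEQ summableI)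
  then have "(\<lambda>n. e + (\<Sum>i<n. f i)) \<longlonglongrightarrow> e + (\<Sum>n. f n)"
    by (intro tendsto_intros)
  moreover have "(\<Sum>n. f n) < e + (\<Sum>n. f n)"
    using ennreal_add_left_cancel_less[of "\<Sum>n. f n" 0 e] assms by (simp add: add.commute)
  ultimately have "eventually (\<lambda>n. (\<Sum>n. f n) < e + (\<Sum>i<n. f i)) sequentially"
    by (rule order_tendstoD)
  then obtain M where M: "(\<Sum>n. f n) < e + (\<Sum>i<M. f i)"
    by (auto simp: eventually_sequentially)
  have "(\<Sum>n. f n) = (\<Sum>n. f (n + M)) + (\<Sum>i<M. f i)"
    by (intro suminf_offset summableI)
  with M have "\<not> e \<le> (\<Sum>n. f (n + M))"
    using add_right_mono[of e "\<Sum>n. f (n + M)" "\<Sum>i<M. f i"] by (auto simp: not_le)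
  then show ?thesis by (auto simp: not_le)
qed

lemma ennreal_suminf_shift_le:
  fixes f :: "nat \<Rightarrow> ennreal"
  assumes "m \<le> M"
  shows "(\<Sum>n. f (n + M)) \<le> (\<Sum>n. f (n + m))"
proof -
  have "(\<Sum>n. f (n + m)) = (\<Sum>n. f (n + (M - m) + m)) + (\<Sum>i<M - m. f (i + m))"
    by (intro suminf_offset[of "\<lambda>n. f (n + m)"] summableI)
  then show ?thesis using assms by (simp add: add.assoc)
qed

lemma ennreal_suminf_div_le:
  fixes f :: "nat \<Rightarrow> ennreal"
  assumes "N > 0"
  shows "(\<Sum>n. f (n div N)) \<le> of_nat N * (\<Sum>n. f n)"
proof (rule suminf_le_const[OF summableI])
  fix n :: nat
  have block: "(\<Sum>i\<in>{m * N..<m * N + N}. f (i div N)) = of_nat N * f m" for m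
  proof -
    have "i div N = m" if "i \<in> {m * N..<m * N + N}" for i
      using that assms by (intro div_nat_eqI) (auto simp: mult.commute)
    then show ?thesis by simp
  qed
  \<comment> \<open>The range is enlarged to a multiple of \<open>N\<close>, so that it splits into
    whole blocks on which \<open>i div N\<close> is constant.\<close>
  have "(\<Sum>i<n. f (i div N)) \<le> (\<Sum>i<n * N. f (i div N))"
    using assms by (intro sum_mono2) (auto intro: less_le_trans)
  also have "\<dots> = (\<Sum>m<n. of_nat N * f m)"
    using sum.nat_group[of "\<lambda>i. f (i div N)" N n] by (simp add: block)
  also have "\<dots> = of_nat N * (\<Sum>m<n. f m)"
    by (simp add: sum_distrib_left)
  also have "\<dots> \<le> of_nat N * (\<Sum>m. f m)"
    by (intro mult_left_mono sum_le_suminf summableI) auto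
  finally show "(\<Sum>i<n. f (i div N)) \<le> of_nat N * (\<Sum>m. f m)" .
qed

section \<open>Monotonicity of the modular and solidity of \<open>ces \<phi>\<close>\<close>

lemma cesaro_mono:
  assumes "\<And>i. \<bar>x i\<bar> \<le> \<bar>y i\<bar>"
  shows "cesaro x n \<le> cesaro y n"
  unfolding cesaro_def by (intro mult_left_mono sum_mono assms) auto

lemma modular_mono:
  assumes "orlicz \<phi>" "\<And>i. \<bar>x i\<bar> \<le> \<bar>y i\<bar>"
  shows "modular \<phi> x \<le> modular \<phi> y"
  unfolding modular_def
  by (intro suminf_le summableI orlicz_mono assms cesaro_nonneg cesaro_mono)

lemma ces_mono:
  assumes "orlicz \<phi>" "y \<in> ces \<phi>" "\<And>i. \<bar>x i\<bar> \<le> \<bar>y i\<bar>"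
  shows "x \<in> ces \<phi>"
proof -
  obtain l where l: "l > 0" "modular \<phi> (\<lambda>i. l * y i) < \<infinity>"
    using assms by (auto simp: ces_def)
  have "modular \<phi> (\<lambda>i. l * x i) \<le> modular \<phi> (\<lambda>i. l * y i)"
    using assms l by (intro modular_mono) (auto simp: abs_mult)
  with l show ?thesis by (auto simp: ces_def intro: le_less_trans)
qed

lemma ces_diff:
  assumes "orlicz \<phi>" "x \<in> ces \<phi>" "y \<in> ces \<phi>"
  shows "x - y \<in> ces \<phi>"
  using ces_add[OF assms(1,2) ces_uminus[OF assms(3)]] by simp

lemma lux_norm_abs: "lux_norm \<phi> (\<lambda>i. \<bar>x i\<bar>) = lux_norm \<phi> x"
  by (simp add: lux_norm_def modular_def cesaro_def)

section \<open>Finite tails of the modular\<close>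

lemma mem_A_ces_iff:
  "x \<in> A_ces \<phi> \<longleftrightarrow>
    x \<in> ces \<phi> \<and> (\<forall>k>0. \<exists>m. (\<Sum>n. \<phi> (k * cesaro x (n + m))) < \<infinity>)"
  by (simp add: A_ces_def cesaro_def)

lemma orlicz_tendsto_0:
  assumes "orlicz \<phi>" "(f \<longlongrightarrow> 0) F"
  shows "((\<lambda>x. \<phi> (f x)) \<longlongrightarrow> 0) F"
  using isCont_tendsto_compose[of 0 \<phi> f F] assms by (simp add: orlicz_def)

text \<open>Convexity at the midpoint of \<open>2 * u\<close> and \<open>2 * v\<close>. The factors
  \<open>1 / 2\<close> are then bounded by 1, because the bound only serves to transfer
  finiteness.\<close>

lemma orlicz_average:
  assumes "orlicz \<phi>" "0 \<le> w" "w \<le> u + v"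
  shows "\<phi> w \<le> \<phi> (2 * u) + \<phi> (2 * v)"
proof -
  have "\<phi> w \<le> \<phi> ((1 - 1 / 2) * (2 * u) + 1 / 2 * (2 * v))"
    using assms by (intro orlicz_mono) auto
  also have "\<dots> \<le> ennreal (1 - 1 / 2) * \<phi> (2 * u) + ennreal (1 / 2) * \<phi> (2 * v)"
  proof -
    have "0 \<le> (1 / 2 :: real)" "1 / 2 \<le> (1::real)" by auto
    then show ?thesis using assms(1) unfolding orlicz_def by blast
  qed
  also have "\<dots> \<le> 1 * \<phi> (2 * u) + 1 * \<phi> (2 * v)"
    by (rule add_mono; rule mult_right_mono; (subst ennreal_le_1)?) auto
  finally show ?thesis by simp
qed

text \<open>Doubling \<open>k\<close> pays for the midpoint estimate. The constant and the tails are
  kept explicit so that the lemma also serves for closedness, where one summand is only known to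
  have small norm.\<close>

lemma modular_tail_add:
  assumes "orlicz \<phi>" "k > 0"
    and "(\<Sum>n. \<phi> (2 * k * cesaro x (n + p))) < \<infinity>" "(\<Sum>n. \<phi> (2 * k * cesaro y (n + q))) < \<infinity>"
  shows "\<exists>m. (\<Sum>n. \<phi> (k * cesaro (x + y) (n + m))) < \<infinity>"
proof (intro exI)
  let ?m = "max p q"
  have "\<phi> (k * cesaro (x + y) n) \<le> \<phi> (2 * k * cesaro x n) + \<phi> (2 * k * cesaro y n)" for n
  proof -
    have "cesaro (x + y) n \<le> cesaro x n + cesaro y n"
      using cesaro_add[of x y n] by (simp add: plus_fun_def)
    then have "k * cesaro (x + y) n \<le> k * cesaro x n + k * cesaro y n"
      using assms(2) by (simp flip: distrib_left)
    then show ?thesis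
      using orlicz_average[of \<phi> "k * cesaro (x + y) n" "k * cesaro x n" "k * cesaro y n"]
        assms(1,2) by (simp add: cesaro_nonneg mult.assoc)
  qed
  then have "(\<Sum>n. \<phi> (k * cesaro (x + y) (n + ?m)))
      \<le> (\<Sum>n. \<phi> (2 * k * cesaro x (n + ?m)) + \<phi> (2 * k * cesaro y (n + ?m)))"
    by (intro suminf_le summableI)
  also have "\<dots> = (\<Sum>n. \<phi> (2 * k * cesaro x (n + ?m))) + (\<Sum>n. \<phi> (2 * k * cesaro y (n + ?m)))"
    by (intro suminf_add[symmetric] summableI)
  also have "\<dots> < \<infinity>"
    using le_less_trans[OF ennreal_suminf_shift_le[of p ?m "\<lambda>n. \<phi> (2 * k * cesaro x n)"] assms(3)]
      le_less_trans[OF ennreal_suminf_shift_le[of q ?m "\<lambda>n. \<phi> (2 * k * cesaro y n)"] assms(4)]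
    by simp
  finally show "(\<Sum>n. \<phi> (k * cesaro (x + y) (n + ?m))) < \<infinity>" .
qed

lemma A_ces_add:
  assumes "orlicz \<phi>" "x \<in> A_ces \<phi>" "y \<in> A_ces \<phi>"
  shows "x + y \<in> A_ces \<phi>"
proof -
  have "\<exists>m. (\<Sum>n. \<phi> (k * cesaro (x + y) (n + m))) < \<infinity>" if "k > 0" for k
  proof -
    have "2 * k > 0" using that by simp
    then obtain p q where "(\<Sum>n. \<phi> (2 * k * cesaro x (n + p))) < \<infinity>"
      "(\<Sum>n. \<phi> (2 * k * cesaro y (n + q))) < \<infinity>"
      using assms unfolding mem_A_ces_iff by blast
    then show ?thesis by (rule modular_tail_add[OF assms(1) that])
  qed
  then show ?thesis using assms by (simp add: mem_A_ces_iff ces_add)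
qed

text \<open>The terms before \<open>m\<close> may be infinite at scale \<open>k\<close>. They are
  finitely many, and continuity of \<phi> at 0 makes all of them finite at some smaller scale
  \<open>l\<close>, at which the tail can only decrease.\<close>

lemma mem_cesI:
  assumes "orlicz \<phi>" "k > 0" "(\<Sum>n. \<phi> (k * cesaro x (n + m))) < \<infinity>"
  shows "x \<in> ces \<phi>"
proof -
  have "eventually (\<lambda>l. \<phi> (l * cesaro x n) < \<infinity>) (at_right 0)" for n
  proof -
    have "((\<lambda>l. l * cesaro x n) \<longlongrightarrow> 0 * cesaro x n) (at_right 0)"
      by (intro tendsto_intros)
    then have "((\<lambda>l. \<phi> (l * cesaro x n)) \<longlongrightarrow> 0) (at_right 0)"
      by (intro orlicz_tendsto_0[OF assms(1)]) simp
    then show ?thesis by (rule order_tendstoD) simp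
  qed
  then have "eventually (\<lambda>l. \<forall>n\<in>{..<m}. \<phi> (l * cesaro x n) < \<infinity>) (at_right 0)"
    by (intro eventually_ball_finite) auto
  moreover have "eventually (\<lambda>l. 0 < l \<and> l < k) (at_right 0)"
    using assms(2) by (auto simp: eventually_at_right)
  ultimately have "eventually (\<lambda>l. (0 < l \<and> l < k) \<and> (\<forall>n\<in>{..<m}. \<phi> (l * cesaro x n) < \<infinity>)) (at_right 0)"
    by (rule eventually_conj[rotated])
  then obtain l where l: "0 < l" "l < k" "\<forall>n\<in>{..<m}. \<phi> (l * cesaro x n) < \<infinity>"
    using eventually_happens trivial_limit_at_right_real by blast
  have "modular \<phi> (\<lambda>i. l * x i) = (\<Sum>n. \<phi> (l * cesaro x n))"
    using l by (simp add: modular_def cesaro_scale)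
  also have "\<dots> = (\<Sum>n. \<phi> (l * cesaro x (n + m))) + (\<Sum>n<m. \<phi> (l * cesaro x n))"
    by (intro suminf_offset summableI)
  also have "\<dots> < \<infinity>"
  proof -
    have "(\<Sum>n. \<phi> (l * cesaro x (n + m))) \<le> (\<Sum>n. \<phi> (k * cesaro x (n + m)))"
      using l by (intro suminf_le summableI orlicz_mono assms(1) mult_right_mono)
        (auto simp: cesaro_nonneg)
    then show ?thesis using assms(3) l(3) by (auto intro: le_less_trans)
  qed
  finally show ?thesis using l(1) by (auto simp: ces_def)
qed

section \<open>Finitely supported sequences and the linear structure of \<open>A_ces\<close>\<close>

lemma orlicz_harmonic_tail:
  assumes "orlicz \<phi>" "ces \<phi> \<noteq> {0}" "k \<ge> 0"
  shows "\<exists>m. (\<Sum>n. \<phi> (k / real (Suc (n + m)))) < \<infinity>"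
proof -
  \<comment> \<open>This excludes an empty \<open>ces \<phi>\<close>, so that
    \<open>ces \<phi> \<noteq> {0}\<close> really yields a nonzero element.\<close>
  have "0 \<in> ces \<phi>"
    using assms(1) unfolding ces_def modular_def cesaro_def orlicz_def
    by (auto intro!: exI[of _ 1])
  then obtain x where x: "x \<in> ces \<phi>" "x \<noteq> 0" using assms(2) by blast
  then obtain j where j: "x j \<noteq> 0" by (auto simp: fun_eq_iff)
  obtain l where l: "l > 0" "modular \<phi> (\<lambda>i. l * x i) < \<infinity>"
    using x by (auto simp: ces_def)
  define a where "a = l * \<bar>x j\<bar>"
  have a: "a > 0" using l j by (simp add: a_def)
  have a_le: "\<phi> (a / real (Suc n)) \<le> \<phi> (l * cesaro x n)" if "n \<ge> j" for n
  proof (rule orlicz_mono[OF assms(1)])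
    have "\<bar>x j\<bar> \<le> (\<Sum>i\<le>n. \<bar>x i\<bar>)"
      using that by (intro member_le_sum[of j _ "\<lambda>i. \<bar>x i\<bar>"]) auto
    then have "\<bar>x j\<bar> / real (Suc n) \<le> cesaro x n"
      by (simp add: cesaro_def divide_right_mono)
    then show "a / real (Suc n) \<le> l * cesaro x n"
      using l mult_left_mono[of "\<bar>x j\<bar> / real (Suc n)" "cesaro x n" l] by (simp add: a_def)
  qed (use a in simp)
  have "(\<Sum>n. \<phi> (a / real (Suc (n + j)))) \<le> (\<Sum>n. \<phi> (l * cesaro x (n + j)))"
    by (intro suminf_le summableI a_le) auto
  also have "\<dots> \<le> (\<Sum>n. \<phi> (l * cesaro x (n + 0)))"
    by (intro ennreal_suminf_shift_le[of 0 j "\<lambda>n. \<phi> (l * cesaro x n)"]) simp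
  also have "\<dots> = modular \<phi> (\<lambda>i. l * x i)"
    using l by (simp add: modular_def cesaro_scale)
  finally have fin: "(\<Sum>n. \<phi> (a / real (Suc (n + j)))) < \<infinity>"
    using l by (auto intro: le_less_trans)
  obtain N0 :: nat where "k / a < real N0" using reals_Archimedean2 by blast
  \<comment> \<open>The successor of \<open>N0\<close> is taken to ensure
    \<open>N > 0\<close>.\<close>
  then obtain N :: nat where N: "N > 0" "k \<le> real N * a"
    using a by (intro that[of "Suc N0"]) (auto simp: field_simps)
  \<comment> \<open>The offset \<open>N * Suc j\<close> is chosen so that
    \<open>N * (n div N + j + 1)\<close> is at most the denominator on the left; then
    \<open>N\<close> cancels against \<open>k \<le> N * a\<close>.\<close>
  have "\<phi> (k / real (Suc (n + N * Suc j))) \<le> \<phi> (a / real (Suc (n div N + j)))" for n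
  proof (rule orlicz_mono[OF assms(1)])
    have "N * (n div N) \<le> Suc n" by (rule le_SucI) simp
    then have "N * Suc (n div N + j) \<le> Suc (n + N * Suc j)"
      by (simp add: algebra_simps)
    then have le: "real N * real (Suc (n div N + j)) \<le> real (Suc (n + N * Suc j))"
      unfolding of_nat_mult[symmetric] of_nat_le_iff .
    have "k / real (Suc (n + N * Suc j)) \<le> (real N * a) / (real N * real (Suc (n div N + j)))"
      using N a le assms(3) by (intro frac_le) auto
    also have "\<dots> = a / real (Suc (n div N + j))"
      using N by simp
    finally show "k / real (Suc (n + N * Suc j)) \<le> a / real (Suc (n div N + j))" .
  qed (use assms(3) in simp)
  then have "(\<Sum>n. \<phi> (k / real (Suc (n + N * Suc j))))
      \<le> (\<Sum>n. \<phi> (a / real (Suc (n div N + j))))"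
    by (intro suminf_le summableI)
  also have "\<dots> \<le> of_nat N * (\<Sum>n. \<phi> (a / real (Suc (n + j))))"
    by (rule ennreal_suminf_div_le[OF N(1), of "\<lambda>n. \<phi> (a / real (Suc (n + j)))"])
  also have "\<dots> < \<infinity>"
    using fin by (simp add: ennreal_mult_less_top of_nat_less_top)
  finally show ?thesis by blast
qed

text \<open>The means are at most \<open>s / (n + 1)\<close> with \<open>s\<close> the sum of all
  absolute values, so the harmonic tail with constant \<open>k * s\<close> dominates. That constant
  is 0 for the zero sequence.\<close>

lemma finite_support_mem_A_ces:
  assumes "orlicz \<phi>" "ces \<phi> \<noteq> {0}" "finite {i. x i \<noteq> 0}"
  shows "x \<in> A_ces \<phi>"
proof -
  define s where "s = (\<Sum>i | x i \<noteq> 0. \<bar>x i\<bar>)"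
  have s: "cesaro x n \<le> s / real (Suc n)" for n
  proof -
    have "(\<Sum>j\<le>n. \<bar>x j\<bar>) = (\<Sum>j\<in>{..n} \<inter> {i. x i \<noteq> 0}. \<bar>x j\<bar>)"
      by (intro sum.mono_neutral_right) auto
    also have "\<dots> \<le> s"
      unfolding s_def using assms(3) by (intro sum_mono2) auto
    finally show ?thesis by (simp add: cesaro_def divide_right_mono)
  qed
  have tail: "\<exists>m. (\<Sum>n. \<phi> (k * cesaro x (n + m))) < \<infinity>" if "k > 0" for k
  proof -
    have "k * s \<ge> 0" using that by (simp add: s_def sum_nonneg)
    then obtain m where m: "(\<Sum>n. \<phi> (k * s / real (Suc (n + m)))) < \<infinity>"
      using orlicz_harmonic_tail[OF assms(1,2)] by blast
    have le: "k * cesaro x n \<le> k * s / real (Suc n)" for n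
      using mult_left_mono[OF s, of k] that by simp
    then have "(\<Sum>n. \<phi> (k * cesaro x (n + m))) \<le> (\<Sum>n. \<phi> (k * s / real (Suc (n + m))))"
      using that by (intro suminf_le summableI orlicz_mono assms(1) le) (simp add: cesaro_nonneg)
    with m show ?thesis by (auto intro: le_less_trans)
  qed
  moreover have "x \<in> ces \<phi>"
    using tail[of 1] mem_cesI[OF assms(1), of 1 x] by auto
  ultimately show ?thesis by (simp add: mem_A_ces_iff)
qed

lemma subspace_A_ces:
  assumes "orlicz \<phi>" "ces \<phi> \<noteq> {0}"
  shows "seq.subspace (A_ces \<phi>)"
proof (rule seq.subspaceI)
  show "0 \<in> A_ces \<phi>"
    by (rule finite_support_mem_A_ces[OF assms]) simp
  show "x + y \<in> A_ces \<phi>" if "x \<in> A_ces \<phi>" "y \<in> A_ces \<phi>" for x y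
    using A_ces_add[OF assms(1) that] .
  show "(\<lambda>i. c * x i) \<in> A_ces \<phi>" if x: "x \<in> A_ces \<phi>" for c x
  \<comment> \<open>For nonzero \<open>c\<close> the scalar is absorbed into the constant,
    \<open>k\<close> becoming \<open>k * \<bar>c\<bar>\<close>, which must stay positive.\<close>
  proof (cases "c = 0")
    case True
    then show ?thesis by (intro finite_support_mem_A_ces[OF assms]) simp
  next
    case False
    have tail: "\<exists>m. (\<Sum>n. \<phi> (k * cesaro (\<lambda>i. c * x i) (n + m))) < \<infinity>" if "k > 0" for k
    proof -
      have "k * \<bar>c\<bar> > 0" using that False by simp
      then show ?thesis
        using x by (simp add: mem_A_ces_iff cesaro_scale flip: mult.assoc)
    qed
    then have "(\<lambda>i. c * x i) \<in> ces \<phi>"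
      using mem_cesI[OF assms(1), of 1 "\<lambda>i. c * x i"] tail[of 1] by auto
    with tail show ?thesis by (simp add: mem_A_ces_iff)
  qed
qed

section \<open>Order continuity and norm closures\<close>

lemma A_ces_order_continuous:
  assumes "orlicz \<phi>" "x \<in> A_ces \<phi>"
  shows "order_continuous \<phi> x"
proof -
  have "(\<lambda>j. lux_norm \<phi> (X j)) \<longlonglongrightarrow> 0"
    if ces: "\<And>j. X j \<in> ces \<phi>" and X: "\<And>j i. 0 \<le> X j i" "\<And>j i. X j i \<le> \<bar>x i\<bar>"
      and lim: "\<And>i. (\<lambda>j. X j i) \<longlonglongrightarrow> 0" for X :: "nat \<Rightarrow> nat \<Rightarrow> real"
  proof (rule LIMSEQ_I)
    fix e :: real assume "e > 0"
    \<comment> \<open>Scaling by \<open>k\<close> is division by \<open>e / 2\<close>: a modular of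
      at most 1 at this scale gives norm at most \<open>e / 2\<close>. The tail and the initial
      terms each get a budget of \<open>1 / 2\<close>.\<close>
    define k where "k = 2 / e"
    have k: "k > 0" using \<open>e > 0\<close> by (simp add: k_def)
    have half: "0 < ennreal (1 / 2)" by (subst ennreal_less_zero_iff) simp
    obtain p where "(\<Sum>n. \<phi> (k * cesaro x (n + p))) < \<infinity>"
      using assms(2) k by (auto simp: mem_A_ces_iff)
    then obtain q where "(\<Sum>n. \<phi> (k * cesaro x (n + q + p))) < ennreal (1 / 2)"
      by (rule ennreal_suminf_tail_less[OF _ half, THEN exE])
    moreover define M where "M = q + p"
    ultimately have M: "(\<Sum>n. \<phi> (k * cesaro x (n + M))) < ennreal (1 / 2)"
      by (simp only: add.assoc)
    have "(\<lambda>j. k * cesaro (X j) n) \<longlonglongrightarrow> k * (1 / real (Suc n) * (\<Sum>i\<le>n. \<bar>0\<bar>))" for n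
      unfolding cesaro_def by (intro tendsto_intros lim)
    then have "(\<lambda>j. \<phi> (k * cesaro (X j) n)) \<longlonglongrightarrow> 0" for n
      by (intro orlicz_tendsto_0[OF assms(1)]) simp
    then have "(\<lambda>j. \<Sum>n<M. \<phi> (k * cesaro (X j) n)) \<longlonglongrightarrow> (\<Sum>n<M. 0)"
      by (intro tendsto_sum)
    then have "eventually (\<lambda>j. (\<Sum>n<M. \<phi> (k * cesaro (X j) n)) < ennreal (1 / 2)) sequentially"
      by (rule order_tendstoD) (simp only: sum.neutral_const half)
    then obtain J where J: "\<And>j. j \<ge> J \<Longrightarrow> (\<Sum>n<M. \<phi> (k * cesaro (X j) n)) < ennreal (1 / 2)"
      by (auto simp: eventually_sequentially)
    have "norm (lux_norm \<phi> (X j) - 0) < e" if "j \<ge> J" for j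
    proof -
      have "modular \<phi> (\<lambda>i. X j i / (e / 2)) = modular \<phi> (\<lambda>i. k * X j i)"
        by (simp add: k_def mult.commute)
      also have "\<dots> = (\<Sum>n. \<phi> (k * cesaro (X j) n))"
        using k by (simp add: modular_def cesaro_scale)
      also have "\<dots> = (\<Sum>n. \<phi> (k * cesaro (X j) (n + M))) + (\<Sum>n<M. \<phi> (k * cesaro (X j) n))"
        by (intro suminf_offset summableI)
      also have "\<dots> \<le> ennreal (1 / 2) + ennreal (1 / 2)"
      proof (intro add_mono)
        \<comment> \<open>Domination by \<open>x\<close> makes the tail bound uniform in
          \<open>j\<close>.\<close>
        have "(\<Sum>n. \<phi> (k * cesaro (X j) (n + M))) \<le> (\<Sum>n. \<phi> (k * cesaro x (n + M)))"
          using k X by (intro suminf_le summableI orlicz_mono assms(1) mult_left_mono cesaro_mono)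
            (auto simp: cesaro_nonneg)
        then show "(\<Sum>n. \<phi> (k * cesaro (X j) (n + M))) \<le> ennreal (1 / 2)"
          by (rule order_trans) (rule less_imp_le[OF M])
        show "(\<Sum>n<M. \<phi> (k * cesaro (X j) n)) \<le> ennreal (1 / 2)"
          using J[OF that] by simp
      qed
      also have "\<dots> = 1" by (subst ennreal_plus[symmetric]) auto
      finally have "lux_norm \<phi> (X j) \<le> e / 2"
        using \<open>e > 0\<close> by (intro lux_norm_le) auto
      moreover have "0 \<le> lux_norm \<phi> (X j)"
        by (rule lux_norm_nonneg[OF assms(1) ces])
      ultimately show ?thesis using \<open>e > 0\<close> by simp
    qed
    then show "\<exists>J. \<forall>j\<ge>J. norm (lux_norm \<phi> (X j) - 0) < e" by blast
  qed
  moreover have "x \<in> ces \<phi>" using assms(2) by (simp add: mem_A_ces_iff)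
  ultimately show ?thesis unfolding order_continuous_def by blast
qed

lemma ces_closure_of:
  assumes "orlicz \<phi>" "S \<subseteq> ces \<phi>"
  shows "ces_topology \<phi> closure_of S =
    {x \<in> ces \<phi>. \<forall>r>0. \<exists>y\<in>S. lux_norm \<phi> (x - y) < r}"
proof -
  interpret Metric_space "ces \<phi>" "ces_dist \<phi>" by (rule Metric_space_ces[OF assms(1)])
  show ?thesis
    unfolding ces_topology_def metric_closure_of using assms(2) by (fastforce simp: ces_dist_def)
qed

lemma topspace_ces_topology:
  assumes "orlicz \<phi>"
  shows "topspace (ces_topology \<phi>) = ces \<phi>"
  unfolding ces_topology_def
  by (rule Metric_space.topspace_mtopology[OF Metric_space_ces[OF assms]])

text \<open>The remainders after truncation are dominated by \<open>\<bar>x\<bar>\<close> and vanish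
  eventually at each coordinate, so order continuity sends their norms to 0.\<close>

lemma order_continuous_closure:
  assumes "orlicz \<phi>" "order_continuous \<phi> x"
  shows "x \<in> ces_topology \<phi> closure_of {x \<in> ces \<phi>. finite {i. x i \<noteq> 0}}"
proof -
  have x: "x \<in> ces \<phi>" using assms(2) by (simp add: order_continuous_def)
  define T where "T m i = (if i < m then x i else 0)" for m i :: nat
  have T: "T m \<in> ces \<phi>" for m
    by (rule ces_mono[OF assms(1) x]) (simp add: T_def)
  have T_finite: "finite {i. T m i \<noteq> 0}" for m
    by (rule finite_subset[of _ "{..<m}"]) (auto simp: T_def)
  \<comment> \<open>Order continuity speaks of nonnegative sequences only;
    \<open>lux_norm_abs\<close> removes the absolute value afterwards.\<close>
  define X where "X m i = \<bar>(x - T m) i\<bar>" for m i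
  have X_le: "X m i \<le> \<bar>x i\<bar>" for m i by (simp add: X_def T_def)
  have X_ces: "X m \<in> ces \<phi>" for m
    by (rule ces_mono[OF assms(1) x]) (simp add: X_def T_def)
  have X_lim: "(\<lambda>m. X m i) \<longlonglongrightarrow> 0" for i
    by (rule tendsto_eventually, rule eventually_sequentiallyI[of "Suc i"]) (simp add: X_def T_def)
  have "0 \<le> X m i" for m i by (simp add: X_def)
  then have "(\<lambda>m. lux_norm \<phi> (X m)) \<longlonglongrightarrow> 0"
    using assms(2) X_le X_ces X_lim unfolding order_continuous_def by blast
  then have lim: "(\<lambda>m. lux_norm \<phi> (x - T m)) \<longlonglongrightarrow> 0"
    unfolding X_def lux_norm_abs .
  have "\<exists>y\<in>{x \<in> ces \<phi>. finite {i. x i \<noteq> 0}}. lux_norm \<phi> (x - y) < r" if "r > 0" for r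
  proof -
    obtain m where "lux_norm \<phi> (x - T m) < r"
      using eventually_happens[OF order_tendstoD(2)[OF lim \<open>r > 0\<close>]] by auto
    then show ?thesis using T T_finite by blast
  qed
  then show ?thesis using x by (subst ces_closure_of[OF assms(1)]) auto
qed

lemma A_ces_closure_subset:
  assumes "orlicz \<phi>" "S \<subseteq> A_ces \<phi>"
  shows "ces_topology \<phi> closure_of S \<subseteq> A_ces \<phi>"
proof
  fix x assume "x \<in> ces_topology \<phi> closure_of S"
  moreover have "S \<subseteq> ces \<phi>" using assms(2) by (auto simp: mem_A_ces_iff)
  ultimately have x: "x \<in> ces \<phi>" "\<And>r. r > 0 \<Longrightarrow> \<exists>y\<in>S. lux_norm \<phi> (x - y) < r"
    by (auto simp: ces_closure_of[OF assms(1)])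
  have "\<exists>m. (\<Sum>n. \<phi> (k * cesaro x (n + m))) < \<infinity>" if "k > 0" for k
  proof -
    have "2 * k > 0" using that by simp
    \<comment> \<open>At distance below \<open>1 / (2 * k)\<close> the modular of
      \<open>2 * k * (x - y)\<close> is at most 1, which is what \<open>modular_tail_add\<close>
      asks of the summand \<open>x - y\<close> in \<open>x = (x - y) + y\<close>.\<close>
    have "1 / (2 * k) > 0" using that by simp
    from x(2)[OF this] obtain y where y: "y \<in> A_ces \<phi>" "lux_norm \<phi> (x - y) < 1 / (2 * k)"
      using assms(2) by blast
    have "modular \<phi> (\<lambda>i. (x - y) i / (1 / (2 * k))) \<le> 1"
      using y x(1) by (intro modular_le_1 ces_diff assms(1)) (auto simp only: mem_A_ces_iff)
    also have "(\<lambda>i. (x - y) i / (1 / (2 * k))) = (\<lambda>i. 2 * k * (x - y) i)"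
      by (simp add: fun_eq_iff mult.commute)
    finally have "(\<Sum>n. \<phi> (2 * k * cesaro (x - y) (n + 0))) \<le> 1"
      using that by (simp only: modular_def cesaro_scale abs_of_pos[OF \<open>2 * k > 0\<close>] add_0_right)
    then have 1: "(\<Sum>n. \<phi> (2 * k * cesaro (x - y) (n + 0))) < \<infinity>"
      by (rule le_less_trans) simp
    obtain m where 2: "(\<Sum>n. \<phi> (2 * k * cesaro y (n + m))) < \<infinity>"
      using y(1) \<open>2 * k > 0\<close> unfolding mem_A_ces_iff by blast
    show ?thesis using modular_tail_add[OF assms(1) that 1 2] by simp
  qed
  then show "x \<in> A_ces \<phi>" using x(1) by (simp add: mem_A_ces_iff)
qed

lemma A_ces_eq_closure:
  assumes "orlicz \<phi>" "ces \<phi> \<noteq> {0}"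
  shows "A_ces \<phi> = ces_topology \<phi> closure_of {x \<in> ces \<phi>. finite {i. x i \<noteq> 0}}"
proof
  show "A_ces \<phi> \<subseteq> ces_topology \<phi> closure_of {x \<in> ces \<phi>. finite {i. x i \<noteq> 0}}"
    using order_continuous_closure[OF assms(1)] A_ces_order_continuous[OF assms(1)] by blast
  show "ces_topology \<phi> closure_of {x \<in> ces \<phi>. finite {i. x i \<noteq> 0}} \<subseteq> A_ces \<phi>"
    using finite_support_mem_A_ces[OF assms] by (intro A_ces_closure_subset[OF assms(1)]) blast
qed

section \<open>Separability\<close>

text \<open>Indexing by lists makes the range countable at once, since \<open>rat list\<close> is a
  countable type.\<close>

definition rat_seq :: "rat list \<Rightarrow> nat \<Rightarrow> real" where
  "rat_seq qs i = (if i < length qs then of_rat (qs ! i) else 0)"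

lemma finite_support_rat_seq: "finite {i. rat_seq qs i \<noteq> 0}"
  by (rule finite_subset[of _ "{..<length qs}"]) (auto simp: rat_seq_def)

text \<open>A coordinatewise error of at most \<open>d\<close> on the first \<open>N\<close> places
  is dominated by \<open>d\<close> times their indicator \<open>u\<close>, which lies in
  \<open>ces \<phi>\<close>.\<close>

lemma rat_seq_approx:
  assumes "orlicz \<phi>" "ces \<phi> \<noteq> {0}" "finite {i. x i \<noteq> 0}" "r > 0"
  shows "\<exists>qs. lux_norm \<phi> (x - rat_seq qs) < r"
proof -
  obtain N where N: "\<And>i. x i \<noteq> 0 \<Longrightarrow> i < N"
    using finite_nat_set_iff_bounded[of "{i. x i \<noteq> 0}"] assms(3) by auto
  define u :: "nat \<Rightarrow> real" where "u i = (if i < N then 1 else 0)" for i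
  have "finite {i. u i \<noteq> 0}"
    by (rule finite_subset[of _ "{..<N}"]) (auto simp: u_def)
  then have "u \<in> ces \<phi>"
    using finite_support_mem_A_ces[OF assms(1,2)] by (auto simp: mem_A_ces_iff)
  from ces_unit[OF assms(1) this]
  obtain a where a: "a > 0" "modular \<phi> (\<lambda>i. u i / a) \<le> 1"
    by blast
  \<comment> \<open>Chosen so that \<open>d * u i / (r / 2)\<close> equals \<open>u i / a\<close>,
    whose modular is at most 1; the error then has norm at most \<open>r / 2\<close>.\<close>
  define d where "d = r / (2 * a)"
  have d: "d > 0" using a assms(4) by (simp add: d_def)
  have "\<exists>q. \<bar>x i - of_rat q\<bar> \<le> d" for i
  proof -
    obtain q where "x i - d < of_rat q" "of_rat q < x i"
      using of_rat_dense[of "x i - d" "x i"] d by auto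
    then show ?thesis by (intro exI[of _ q]) simp
  qed
  then obtain q where q: "\<And>i. \<bar>x i - of_rat (q i)\<bar> \<le> d" by metis
  define qs where "qs = map q [0..<N]"
  have le: "\<bar>(x - rat_seq qs) i\<bar> \<le> d * u i" for i
    using q[of i] N[of i] by (auto simp: rat_seq_def qs_def u_def)
  have "\<bar>(x - rat_seq qs) i / (r / 2)\<bar> \<le> \<bar>u i / a\<bar>" for i
  proof -
    have "\<bar>(x - rat_seq qs) i / (r / 2)\<bar> \<le> d * u i / (r / 2)"
      using le[of i] assms(4) by (simp add: abs_divide divide_right_mono)
    also have "\<dots> = \<bar>u i / a\<bar>"
      using assms(4) a by (simp add: d_def u_def)
    finally show ?thesis .
  qed
  then have "modular \<phi> (\<lambda>i. (x - rat_seq qs) i / (r / 2)) \<le> modular \<phi> (\<lambda>i. u i / a)"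
    by (rule modular_mono[OF assms(1)])
  also note a(2)
  finally have "lux_norm \<phi> (x - rat_seq qs) \<le> r / 2"
    using assms(4) by (intro lux_norm_le) auto
  then show ?thesis using assms(4) by (intro exI[of _ qs]) simp
qed

text \<open>The closure of the rational sequences contains the finitely supported ones, hence also
  their closure, which is \<open>A_ces \<phi>\<close>.\<close>

lemma separable_A_ces:
  assumes "orlicz \<phi>" "ces \<phi> \<noteq> {0}"
  shows "separable_space (subtopology (ces_topology \<phi>) (A_ces \<phi>))"
proof -
  let ?F = "{x \<in> ces \<phi>. finite {i. x i \<noteq> 0}}" and ?D = "range rat_seq"
  have D: "?D \<subseteq> A_ces \<phi>"
    using finite_support_mem_A_ces[OF assms] finite_support_rat_seq by blast
  have A: "A_ces \<phi> \<subseteq> ces \<phi>" by (auto simp: mem_A_ces_iff)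
  have D_ces: "?D \<subseteq> ces \<phi>" using D A by (rule order_trans)
  have "?F \<subseteq> ces_topology \<phi> closure_of ?D"
    unfolding ces_closure_of[OF assms(1) D_ces] using rat_seq_approx[OF assms] by blast
  then have "ces_topology \<phi> closure_of ?F \<subseteq> ces_topology \<phi> closure_of ?D"
    by (rule closure_of_minimal[OF _ closedin_closure_of])
  then have dense: "A_ces \<phi> \<subseteq> ces_topology \<phi> closure_of ?D"
    using A_ces_eq_closure[OF assms] by simp
  show ?thesis
    unfolding separable_space_def
  proof (intro exI conjI)
    show "countable ?D" by simp
    show "?D \<subseteq> topspace (subtopology (ces_topology \<phi>) (A_ces \<phi>))"
      using D D_ces by (simp add: topspace_ces_topology[OF assms(1)])
    show "subtopology (ces_topology \<phi>) (A_ces \<phi>) closure_of ?D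
        = topspace (subtopology (ces_topology \<phi>) (A_ces \<phi>))"
      using D A dense
      by (auto simp: closure_of_subtopology topspace_ces_topology[OF assms(1)] Int_absorb1)
  qed
qed

theorem theorem2p3:
  fixes \<phi> :: "real \<Rightarrow> ennreal"
  assumes "orlicz \<phi>"
    and "ces \<phi> \<noteq> {0}"
  shows "(seq.subspace (A_ces \<phi>)
          \<and> closedin (ces_topology \<phi>) (A_ces \<phi>)
          \<and> separable_space (subtopology (ces_topology \<phi>) (A_ces \<phi>)))
       \<and> A_ces \<phi> = ces_topology \<phi> closure_of {x \<in> ces \<phi>. finite {i. x i \<noteq> 0}}
       \<and> A_ces \<phi> = {x. order_continuous \<phi> x}"
proof (intro conjI)
  show "seq.subspace (A_ces \<phi>)" by (rule subspace_A_ces[OF assms])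
  show "closedin (ces_topology \<phi>) (A_ces \<phi>)"
    by (subst A_ces_eq_closure[OF assms]) (rule closedin_closure_of)
  show "separable_space (subtopology (ces_topology \<phi>) (A_ces \<phi>))"
    by (rule separable_A_ces[OF assms])
  show "A_ces \<phi> = ces_topology \<phi> closure_of {x \<in> ces \<phi>. finite {i. x i \<noteq> 0}}"
    by (rule A_ces_eq_closure[OF assms])
  \<comment> \<open>Order continuous elements lie in the closure, which the preceding equation
    identifies with \<open>A_ces \<phi>\<close>.\<close>
  then show "A_ces \<phi> = {x. order_continuous \<phi> x}"
    using A_ces_order_continuous[OF assms(1)] order_continuous_closure[OF assms(1)] by blast
qed

end
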